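(* Let $G$ be a group generated as a monoid by a subset $A\subseteq G$ closed under $G$-conjugation, and fix $c\in G$ with $\ell_A(c)=n$. If $\mathcal{P}_c(G,A)$ is chain-connected and locally Hurwitz-connected, then $B_n$ acts transitively on $\mathrm{Red}_A(c)$ by the Hurwitz action, i.e., $\mathcal{P}_c$ is Hurwitz-connected.
   Context: For $x\in G$, $\ell_A(x)$ is the least $k\ge 0$ such that $x$ is a product of $k$ elements of $A$. Such a product with $k=\ell_A(x)$, written as a tuple, is a reduced $A$-factorization; $\mathrm{Red}_A(x)$ is the set of these. The $A$-prefix order is $x\le_A y$ iff $\ell_A(x)+\ell_A(x^{-1}y)=\ell_A(y)$. The factorization poset $\mathcal{P}_c(G,A)$ is $\{x: e\le_A x\le_A c\}$ ordered by $\le_A$. For $m\ge1$ and $x$ with $\ell_A(x)=m$, the braid group $B_m$ acts on $\mathrm{Red}_A(x)$ (Hurwitz action) by $\sigma_i\cdot(a_1,\dots,a_m)=(a_1,\dots,a_{i-1},a_{i+1},a_{i+1}^{-1}a_ia_{i+1},a_{i+2},\dots,a_m)$. The chain graph of $\mathcal{P}_c$ has the maximal chains as vertices, two being adjacent when they differ in exactly one element; $\mathcal{P}_c$ is chain-connected if this graph is connected. $\mathcal{P}_c$ is locally Hurwitz-connected if for every $g\le_A c$ with $\ell_A(g)=2$, $B_2$ acts transitively on $\mathrm{Red}_A(g)$. *)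

theory Defs
  imports "HOL-Algebra.Group_Action" "HOL-Library.FuncSet"
begin

definition list_prod :: "('a, 'b) monoid_scheme \<Rightarrow> 'a list \<Rightarrow> 'a" where
  "list_prod G as = foldr (\<otimes>\<^bsub>G\<^esub>) as \<one>\<^bsub>G\<^esub>"

definition generates_as_monoid :: "('a, 'b) monoid_scheme \<Rightarrow> 'a set \<Rightarrow> bool" where
  "generates_as_monoid G A \<longleftrightarrow>
     A \<subseteq> carrier G \<and> (\<forall>x\<in>carrier G. \<exists>as. set as \<subseteq> A \<and> list_prod G as = x)"

definition conjugation_closed :: "('a, 'b) monoid_scheme \<Rightarrow> 'a set \<Rightarrow> bool" where
  "conjugation_closed G A \<longleftrightarrow>
     (\<forall>a\<in>A. \<forall>g\<in>carrier G. inv\<^bsub>G\<^esub> g \<otimes>\<^bsub>G\<^esub> a \<otimes>\<^bsub>G\<^esub> g \<in> A)"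

text \<open>Only meaningful on products of elements of \<open>A\<close>; if \<open>A\<close> generates \<open>G\<close> as a
  monoid this is all of \<open>carrier G\<close>.\<close>

definition word_length :: "('a, 'b) monoid_scheme \<Rightarrow> 'a set \<Rightarrow> 'a \<Rightarrow> nat" where
  "word_length G A x = (LEAST k. \<exists>as. length as = k \<and> set as \<subseteq> A \<and> list_prod G as = x)"

definition Red :: "('a, 'b) monoid_scheme \<Rightarrow> 'a set \<Rightarrow> 'a \<Rightarrow> 'a list set" where
  "Red G A x = {as. length as = word_length G A x \<and> set as \<subseteq> A \<and> list_prod G as = x}"

definition prefix_le :: "('a, 'b) monoid_scheme \<Rightarrow> 'a set \<Rightarrow> 'a \<Rightarrow> 'a \<Rightarrow> bool" where
  "prefix_le G A x y \<longleftrightarrow>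
     word_length G A x + word_length G A (inv\<^bsub>G\<^esub> x \<otimes>\<^bsub>G\<^esub> y) = word_length G A y"

definition factorization_poset :: "('a, 'b) monoid_scheme \<Rightarrow> 'a set \<Rightarrow> 'a \<Rightarrow> 'a set" where
  "factorization_poset G A c =
     {x \<in> carrier G. prefix_le G A \<one>\<^bsub>G\<^esub> x \<and> prefix_le G A x c}"

definition max_chains :: "('a, 'b) monoid_scheme \<Rightarrow> 'a set \<Rightarrow> 'a \<Rightarrow> 'a set set" where
  "max_chains G A c = {C. pred_on.maxchain (factorization_poset G A c) (prefix_le G A) C}"

text \<open>Maximal chains all have the same number of elements, so two of them differ in
  exactly one element when one arises from the other by replacing a single element.\<close>

definition chain_graph :: "('a, 'b) monoid_scheme \<Rightarrow> 'a set \<Rightarrow> 'a \<Rightarrow> 'a set rel" where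
  "chain_graph G A c =
     {(C, D) \<in> max_chains G A c \<times> max_chains G A c. card (C - D) = 1 \<and> card (D - C) = 1}"

definition chain_connected :: "('a, 'b) monoid_scheme \<Rightarrow> 'a set \<Rightarrow> 'a \<Rightarrow> bool" where
  "chain_connected G A c \<longleftrightarrow>
     (\<forall>C\<in>max_chains G A c. \<forall>D\<in>max_chains G A c. (C, D) \<in> (chain_graph G A c)\<^sup>*)"

datatype braid_letter = Gen nat | GenInv nat

primrec letter_index :: "braid_letter \<Rightarrow> nat" where
  "letter_index (Gen i) = i"
| "letter_index (GenInv i) = i"

definition braid_words :: "nat \<Rightarrow> braid_letter list set" where
  "braid_words m = {w. \<forall>l\<in>set w. 1 \<le> letter_index l \<and> letter_index l < m}"

inductive braid_relation :: "braid_letter list \<Rightarrow> braid_letter list \<Rightarrow> bool" where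
  cancel_right: "braid_relation [Gen i, GenInv i] []"
| cancel_left: "braid_relation [GenInv i, Gen i] []"
| far: "i + 2 \<le> j \<Longrightarrow> braid_relation [Gen i, Gen j] [Gen j, Gen i]"
| braid: "braid_relation [Gen i, Gen (i + 1), Gen i] [Gen (i + 1), Gen i, Gen (i + 1)]"

inductive braid_step :: "nat \<Rightarrow> braid_letter list \<Rightarrow> braid_letter list \<Rightarrow> bool" for m where
  "braid_relation u v \<Longrightarrow> p @ u @ s \<in> braid_words m \<Longrightarrow> p @ v @ s \<in> braid_words m
     \<Longrightarrow> braid_step m (p @ u @ s) (p @ v @ s)"

definition braid_equiv :: "nat \<Rightarrow> braid_letter list rel" where
  "braid_equiv m = {(u, v) \<in> braid_words m \<times> braid_words m. equivclp (braid_step m) u v}"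

text \<open>For \<open>m \<le> 1\<close> there are no generators and the group is trivial.\<close>

definition braid_group :: "nat \<Rightarrow> braid_letter list set monoid" where
  "braid_group m =
     \<lparr>carrier = braid_words m // braid_equiv m,
      mult = (\<lambda>X Y. \<Union>u\<in>X. \<Union>v\<in>Y. braid_equiv m `` {u @ v}),
      one = braid_equiv m `` {[]}\<rparr>"

text \<open>The index \<open>i\<close> of a braid generator starts at 1, whereas list positions start at 0.\<close>

fun hurwitz_letter :: "('a, 'b) monoid_scheme \<Rightarrow> braid_letter \<Rightarrow> 'a list \<Rightarrow> 'a list" where
  "hurwitz_letter G (Gen i) as =
     (let a = as ! (i - 1); b = as ! i
      in as[i - 1 := b, i := inv\<^bsub>G\<^esub> b \<otimes>\<^bsub>G\<^esub> a \<otimes>\<^bsub>G\<^esub> b])"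
| "hurwitz_letter G (GenInv i) as =
     (let a = as ! (i - 1); b = as ! i
      in as[i - 1 := a \<otimes>\<^bsub>G\<^esub> b \<otimes>\<^bsub>G\<^esub> inv\<^bsub>G\<^esub> a, i := a])"

definition hurwitz_word :: "('a, 'b) monoid_scheme \<Rightarrow> braid_letter list \<Rightarrow> 'a list \<Rightarrow> 'a list" where
  "hurwitz_word G w as = foldr (hurwitz_letter G) w as"

text \<open>All words representing a braid act in the same way, so the image below is a
  singleton; this is what makes
  \<open>hurwitz_group_action\<close> below hold.\<close>

definition hurwitz_action ::
  "('a, 'b) monoid_scheme \<Rightarrow> 'a set \<Rightarrow> 'a \<Rightarrow> braid_letter list set \<Rightarrow> 'a list \<Rightarrow> 'a list" where
  "hurwitz_action G A x = (\<lambda>\<beta>. \<lambda>as\<in>Red G A x. the_elem ((\<lambda>w. hurwitz_word G w as) ` \<beta>))"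

definition locally_hurwitz_connected :: "('a, 'b) monoid_scheme \<Rightarrow> 'a set \<Rightarrow> 'a \<Rightarrow> bool" where
  "locally_hurwitz_connected G A c \<longleftrightarrow>
     (\<forall>g\<in>carrier G. prefix_le G A g c \<and> word_length G A g = 2 \<longrightarrow>
        transitive_action (braid_group 2) (Red G A g) (hurwitz_action G A g))"

lemma braid_words_append [simp]: "u @ v \<in> braid_words m \<longleftrightarrow> u \<in> braid_words m \<and> v \<in> braid_words m"
  by (auto simp: braid_words_def)

lemma Nil_braid_words [simp]: "[] \<in> braid_words m"
  by (simp add: braid_words_def)

lemma braid_step_append:
  assumes "braid_step m u v" "p \<in> braid_words m" "s \<in> braid_words m"
  shows "braid_step m (p @ u @ s) (p @ v @ s)"
  using assms
proof (cases rule: braid_step.cases)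
  case (1 u' v' p' s')
  then show ?thesis
    using braid_step.intros[of u' v' "p @ p'" "s' @ s" m] assms by simp
qed

lemma equivclp_braid_step_append:
  assumes "equivclp (braid_step m) u v" "p \<in> braid_words m" "s \<in> braid_words m"
  shows "equivclp (braid_step m) (p @ u @ s) (p @ v @ s)"
  using assms(1)
proof (induction rule: equivclp_induct)
  case base
  then show ?case by simp
next
  case (step y z)
  have "braid_step m (p @ y @ s) (p @ z @ s) \<or> braid_step m (p @ z @ s) (p @ y @ s)"
    using step(2) braid_step_append[OF _ assms(2,3)] by blast
  with step(3) show ?case by (meson equivclp_into_equivclp)
qed

lemma equiv_braid_equiv: "equiv (braid_words m) (braid_equiv m)"
proof (rule equivI)
  show "refl_on (braid_words m) (braid_equiv m)"
    by (auto simp: refl_on_def braid_equiv_def)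
  show "sym (braid_equiv m)"
    by (auto simp: sym_def braid_equiv_def intro: equivclp_sym)
  show "trans (braid_equiv m)"
    by (auto simp: trans_def braid_equiv_def intro: equivclp_trans)
  show "braid_equiv m \<subseteq> braid_words m \<times> braid_words m"
    by (auto simp: braid_equiv_def)
qed

lemma braid_equiv_append:
  assumes "(u, u') \<in> braid_equiv m" "(v, v') \<in> braid_equiv m"
  shows "(u @ v, u' @ v') \<in> braid_equiv m"
proof -
  have "equivclp (braid_step m) (u @ v) (u' @ v)"
    using equivclp_braid_step_append[of m u u' "[]" v] assms by (auto simp: braid_equiv_def)
  moreover have "equivclp (braid_step m) (u' @ v) (u' @ v')"
    using equivclp_braid_step_append[of m v v' u' "[]"] assms by (auto simp: braid_equiv_def)
  ultimately show ?thesis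
    using assms by (auto simp: braid_equiv_def intro: equivclp_trans)
qed

lemma congruent2_append:
  "congruent2 (braid_equiv m) (braid_equiv m) (\<lambda>u v. braid_equiv m `` {u @ v})"
  by (rule congruent2I'[OF equiv_class_eq[OF equiv_braid_equiv braid_equiv_append]])

lemma braid_mult:
  assumes "u \<in> braid_words m" "v \<in> braid_words m"
  shows "braid_equiv m `` {u} \<otimes>\<^bsub>braid_group m\<^esub> braid_equiv m `` {v} = braid_equiv m `` {u @ v}"
  using UN_equiv_class2[OF equiv_braid_equiv equiv_braid_equiv congruent2_append assms]
  by (simp add: braid_group_def)

primrec letter_inverse :: "braid_letter \<Rightarrow> braid_letter" where
  "letter_inverse (Gen i) = GenInv i"
| "letter_inverse (GenInv i) = Gen i"

lemma letter_index_inverse [simp]: "letter_index (letter_inverse l) = letter_index l"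
  by (cases l) auto

lemma braid_word_left_inverse:
  assumes "w \<in> braid_words m"
  shows "rev (map letter_inverse w) \<in> braid_words m
    \<and> equivclp (braid_step m) (rev (map letter_inverse w) @ w) []"
  using assms
proof (induction w)
  case Nil
  then show ?case by simp
next
  case (Cons l w)
  let ?r = "rev (map letter_inverse w)"
  have l: "[letter_inverse l, l] \<in> braid_words m" and w: "w \<in> braid_words m"
    using Cons.prems by (auto simp: braid_words_def)
  have "braid_relation [letter_inverse l, l] []"
    by (cases l) (auto intro: braid_relation.intros)
  then have "braid_step m (?r @ [letter_inverse l, l] @ w) (?r @ [] @ w)"
    by (rule braid_step.intros) (use Cons.IH[OF w] l w in \<open>simp_all only: braid_words_append Nil_braid_words simp_thms\<close>)
  then have "equivclp (braid_step m) (?r @ [letter_inverse l, l] @ w) (?r @ w)"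
    by auto
  with Cons.IH[OF w] l show ?case
    by (auto simp: braid_words_def intro: equivclp_trans)
qed

lemma group_braid_group: "group (braid_group m)"
proof (rule groupI)
  have carrier: "carrier (braid_group m) = braid_words m // braid_equiv m"
    and one: "\<one>\<^bsub>braid_group m\<^esub> = braid_equiv m `` {[]}"
    by (simp_all add: braid_group_def)
  note [simp] = carrier one braid_mult
  show "\<one>\<^bsub>braid_group m\<^esub> \<in> carrier (braid_group m)"
    by (simp add: quotientI)
  fix x y z assume "x \<in> carrier (braid_group m)"
  then obtain u where u: "x = braid_equiv m `` {u}" "u \<in> braid_words m"
    by (auto elim: quotientE)
  show "\<one>\<^bsub>braid_group m\<^esub> \<otimes>\<^bsub>braid_group m\<^esub> x = x"
    using u by simp
  show "\<exists>y\<in>carrier (braid_group m). y \<otimes>\<^bsub>braid_group m\<^esub> x = \<one>\<^bsub>braid_group m\<^esub>"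
  proof (rule bexI)
    let ?r = "rev (map letter_inverse u)"
    have "?r \<in> braid_words m" "(?r @ u, []) \<in> braid_equiv m"
      using braid_word_left_inverse[OF u(2)] u(2) by (auto simp: braid_equiv_def)
    then show "braid_equiv m `` {?r} \<otimes>\<^bsub>braid_group m\<^esub> x = \<one>\<^bsub>braid_group m\<^esub>"
      and "braid_equiv m `` {?r} \<in> carrier (braid_group m)"
      using u equiv_class_eq[OF equiv_braid_equiv] by (auto intro: quotientI)
  qed
  assume "y \<in> carrier (braid_group m)"
  then obtain v where v: "y = braid_equiv m `` {v}" "v \<in> braid_words m"
    by (auto elim: quotientE)
  show "x \<otimes>\<^bsub>braid_group m\<^esub> y \<in> carrier (braid_group m)"
    using u v by (simp add: quotientI)
  assume "z \<in> carrier (braid_group m)"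
  then obtain w where w: "z = braid_equiv m `` {w}" "w \<in> braid_words m"
    by (auto elim: quotientE)
  show "x \<otimes>\<^bsub>braid_group m\<^esub> y \<otimes>\<^bsub>braid_group m\<^esub> z = x \<otimes>\<^bsub>braid_group m\<^esub> (y \<otimes>\<^bsub>braid_group m\<^esub> z)"
    using u v w by simp
qed

lemma (in group) list_prod_append:
  "set as \<subseteq> carrier G \<Longrightarrow> set bs \<subseteq> carrier G \<Longrightarrow>
    list_prod G (as @ bs) = list_prod G as \<otimes> list_prod G bs \<and> list_prod G as \<in> carrier G"
proof (induction as)
  case Nil
  have "list_prod G bs \<in> carrier G"
    using Nil(2) by (induction bs) (auto simp: list_prod_def)
  then show ?case by (simp add: list_prod_def)
next
  case (Cons a as)
  have "list_prod G bs \<in> carrier G"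
    using Cons(3) by (induction bs) (auto simp: list_prod_def)
  with Cons show ?case by (auto simp: list_prod_def m_assoc)
qed

lemma list_split2:
  assumes "1 \<le> i" "i < length as"
  obtains p a b s where "as = p @ a # b # s" "length p = i - 1"
proof -
  have "as = take (i-1) as @ as ! (i-1) # as ! i # drop (Suc i) as"
    using assms by (metis Cons_nth_drop_Suc Suc_diff_1 append_take_drop_id less_imp_diff_less less_le_trans zero_less_one)
  with that show thesis using assms by (metis length_take less_imp_diff_less min.absorb4)
qed

lemma hurwitz_Gen_split:
  assumes "length p = i - 1" "1 \<le> i"
  shows "hurwitz_letter G (Gen i) (p @ a # b # s) = p @ b # (inv\<^bsub>G\<^esub> b \<otimes>\<^bsub>G\<^esub> a \<otimes>\<^bsub>G\<^esub> b) # s"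
    and "hurwitz_letter G (GenInv i) (p @ a # b # s) = p @ (a \<otimes>\<^bsub>G\<^esub> b \<otimes>\<^bsub>G\<^esub> inv\<^bsub>G\<^esub> a) # a # s"
proof -
  have i: "i = Suc (length p)" using assms by simp
  show "hurwitz_letter G (Gen i) (p @ a # b # s) = p @ b # (inv\<^bsub>G\<^esub> b \<otimes>\<^bsub>G\<^esub> a \<otimes>\<^bsub>G\<^esub> b) # s"
    "hurwitz_letter G (GenInv i) (p @ a # b # s) = p @ (a \<otimes>\<^bsub>G\<^esub> b \<otimes>\<^bsub>G\<^esub> inv\<^bsub>G\<^esub> a) # a # s"
    by (simp_all add: i Let_def nth_append list_update_append)
qed

context group
begin

lemma inv_cancels:
  assumes "x \<in> carrier G" "y \<in> carrier G"
  shows "x \<otimes> (inv x \<otimes> y) = y" "inv x \<otimes> (x \<otimes> y) = y"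
  using assms by (simp_all add: m_assoc[symmetric])

lemma hurwitz_letter_Red:
  assumes A: "A \<subseteq> carrier G" "conjugation_closed G A"
    and as: "as \<in> Red G A x" and l: "1 \<le> letter_index l" "letter_index l < word_length G A x"
  shows "hurwitz_letter G l as \<in> Red G A x"
proof -
  have len: "letter_index l < length as" using as l by (auto simp: Red_def)
  obtain p a b s where asp: "as = p @ a # b # s" "length p = letter_index l - 1"
    by (rule list_split2[OF l(1) len])
  have inA: "set p \<subseteq> A" "a \<in> A" "b \<in> A" "set s \<subseteq> A"
    using as asp by (auto simp: Red_def)
  then have c: "set p \<subseteq> carrier G" "a \<in> carrier G" "b \<in> carrier G" "set s \<subseteq> carrier G"
    using A by auto
  have sc: "list_prod G s \<in> carrier G" using list_prod_append[OF c(4), of "[]"] by simp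
  have pr: "list_prod G (p @ u # v # s) = list_prod G p \<otimes> (u \<otimes> v \<otimes> list_prod G s)"
    if "u \<in> carrier G" "v \<in> carrier G" for u v
    using list_prod_append[OF c(1), of "u # v # s"] that c sc
    by (auto simp: list_prod_def m_assoc)
  have k1: "inv b \<otimes> a \<otimes> b \<in> A" using A inA c by (auto simp: conjugation_closed_def)
  have "inv (inv a) \<otimes> b \<otimes> inv a \<in> A" using A inA c unfolding conjugation_closed_def by (metis inv_closed)
  then have k2: "a \<otimes> b \<otimes> inv a \<in> A" using c by simp
  have e1: "b \<otimes> (inv b \<otimes> a \<otimes> b) = a \<otimes> b" using c by (simp add: m_assoc inv_cancels)
  have e2: "a \<otimes> b \<otimes> inv a \<otimes> a = a \<otimes> b" using c by (simp add: m_assoc)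
  show ?thesis
  proof (cases l)
    case (Gen i)
    then show ?thesis
      using as asp l inA k1 pr[of a b] pr[of b "inv b \<otimes> a \<otimes> b"] c e1 hurwitz_Gen_split(1)[of p i G a b s]
      by (auto simp: Red_def)
  next
    case (GenInv i)
    then show ?thesis
      using as asp l inA k2 pr[of a b] pr[of "a \<otimes> b \<otimes> inv a" a] c e2 hurwitz_Gen_split(2)[of p i G a b s]
      by (auto simp: Red_def)
  qed
qed

lemma hurwitz_word_append: "hurwitz_word G (u @ v) as = hurwitz_word G u (hurwitz_word G v as)"
  by (simp add: hurwitz_word_def)

lemma hurwitz_word_Red:
  assumes A: "A \<subseteq> carrier G" "conjugation_closed G A"
    and w: "w \<in> braid_words (word_length G A x)" and as: "as \<in> Red G A x"
  shows "hurwitz_word G w as \<in> Red G A x"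
  using w
  by (induction w) (auto simp: hurwitz_word_def as braid_words_def intro!: hurwitz_letter_Red[OF A])

lemma hurwitz_relation:
  assumes r: "braid_relation u v" and w: "u \<in> braid_words m" "v \<in> braid_words m"
    and as: "length as = m" "set as \<subseteq> carrier G"
  shows "hurwitz_word G u as = hurwitz_word G v as"
  using r
proof cases
  case (cancel_right i)
  then have i: "1 \<le> i" "i < length as" using w as by (auto simp: braid_words_def)
  obtain p a b s where asp: "as = p @ a # b # s" "length p = i - 1"
    by (rule list_split2[OF i])
  then show ?thesis using cancel_right i as
    by (simp add: hurwitz_word_def hurwitz_Gen_split m_assoc inv_cancels del: hurwitz_letter.simps)
next
  case (cancel_left i)
  then have i: "1 \<le> i" "i < length as" using w as by (auto simp: braid_words_def)
  obtain p a b s where asp: "as = p @ a # b # s" "length p = i - 1"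
    by (rule list_split2[OF i])
  then show ?thesis using cancel_left i as
    by (simp add: hurwitz_word_def hurwitz_Gen_split m_assoc inv_cancels del: hurwitz_letter.simps)
next
  case (far i j)
  then have "1 \<le> i" "j < length as" using w as by (auto simp: braid_words_def)
  with far show ?thesis
    by (simp add: hurwitz_word_def Let_def nth_list_update list_update_swap)
next
  case (braid i)
  then have i: "1 \<le> i" "Suc i < length as" using w as by (auto simp: braid_words_def)
  then have "i < length as" by simp
  then obtain p a b s' where asp: "as = p @ a # b # s'" "length p = i - 1"
    by (rule list_split2[OF i(1)])
  obtain d s where s': "s' = d # s"
    using i asp by (cases s') auto
  have ac: "a \<in> carrier G" "b \<in> carrier G" "d \<in> carrier G" using as asp s' by auto
  have s1: "hurwitz_letter G (Gen i) (p @ x # y # z # s) = p @ y # (inv y \<otimes> x \<otimes> y) # z # s" for x y z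
    by (rule hurwitz_Gen_split) (use asp i in auto)
  have s2: "hurwitz_letter G (Gen (Suc i)) (p @ x # y # z # s) = p @ x # z # (inv z \<otimes> y \<otimes> z) # s" for x y z
    using hurwitz_Gen_split(1)[of "p @ [x]" "Suc i" G y z s] asp i by simp
  have e: "inv (inv d \<otimes> b \<otimes> d) \<otimes> (inv d \<otimes> a \<otimes> d) \<otimes> (inv d \<otimes> b \<otimes> d) = inv d \<otimes> (inv b \<otimes> a \<otimes> b) \<otimes> d"
    using ac by (simp add: m_assoc inv_cancels inv_mult_group)
  have as': "as = p @ a # b # d # s" by (simp add: asp s')
  show ?thesis
    unfolding braid as' hurwitz_word_def
    by (simp add: s1 s2 e del: hurwitz_letter.simps)
qed

lemma hurwitz_word_equiv:
  assumes A: "A \<subseteq> carrier G" "conjugation_closed G A"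
    and uv: "(u, v) \<in> braid_equiv (word_length G A x)" and as: "as \<in> Red G A x"
  shows "hurwitz_word G u as = hurwitz_word G v as"
proof -
  have step: "hurwitz_word G y as = hurwitz_word G z as"
    if "braid_step (word_length G A x) y z" for y z
    using that
  proof cases
    case (1 u' v' p s)
    have "hurwitz_word G s as \<in> Red G A x"
      by (rule hurwitz_word_Red[OF A _ as]) (use 1 in simp)
    then have "hurwitz_word G u' (hurwitz_word G s as) = hurwitz_word G v' (hurwitz_word G s as)"
      using 1 A by (intro hurwitz_relation[where m = "word_length G A x"]) (auto simp: Red_def)
    then show ?thesis using 1 by (simp add: hurwitz_word_append)
  qed
  have "equivclp (braid_step (word_length G A x)) u v" using uv by (simp add: braid_equiv_def)
  then show ?thesis
    by (induction rule: equivclp_induct) (auto dest: step)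
qed

lemma hurwitz_action_class:
  assumes A: "A \<subseteq> carrier G" "conjugation_closed G A"
    and w: "w \<in> braid_words (word_length G A x)" and as: "as \<in> Red G A x"
  shows "hurwitz_action G A x (braid_equiv (word_length G A x) `` {w}) as = hurwitz_word G w as"
proof -
  have "w \<in> braid_equiv (word_length G A x) `` {w}"
    using w equiv_class_self[OF equiv_braid_equiv] by blast
  moreover have "hurwitz_word G v as = hurwitz_word G w as"
    if "v \<in> braid_equiv (word_length G A x) `` {w}" for v
    using hurwitz_word_equiv[OF A _ as, of w v] that by simp
  ultimately have "(\<lambda>v. hurwitz_word G v as) ` (braid_equiv (word_length G A x) `` {w}) = {hurwitz_word G w as}"
    by blast
  then show ?thesis using as by (simp add: hurwitz_action_def)
qed

lemma hurwitz_group_action: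
  assumes A: "A \<subseteq> carrier G" "conjugation_closed G A"
  shows "group_action (braid_group (word_length G A x)) (Red G A x) (hurwitz_action G A x)"
proof -
  define m where "m = word_length G A x"
  define h where "h = hurwitz_action G A x"
  note cl = hurwitz_action_class[OF A, where x = x, folded m_def h_def]
  note red = hurwitz_word_Red[OF A, where x = x, folded m_def]
  interpret B: group "braid_group m" by (rule group_braid_group)
  have carrier: "carrier (braid_group m) = braid_words m // braid_equiv m"
    and one: "\<one>\<^bsub>braid_group m\<^esub> = braid_equiv m `` {[]}"
    by (simp_all add: braid_group_def)
  have maps: "h g as \<in> Red G A x" if "g \<in> carrier (braid_group m)" "as \<in> Red G A x" for g as
    using that by (auto simp: carrier cl red elim!: quotientE)
  have mult: "h (g \<otimes>\<^bsub>braid_group m\<^esub> k) as = h g (h k as)"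
    if "g \<in> carrier (braid_group m)" "k \<in> carrier (braid_group m)" "as \<in> Red G A x" for g k as
    using that by (auto simp: carrier braid_mult cl red hurwitz_word_append elim!: quotientE)
  have one': "h \<one>\<^bsub>braid_group m\<^esub> as = as" if "as \<in> Red G A x" for as
    using that by (simp add: one cl hurwitz_word_def)
  have bij: "h g \<in> Bij (Red G A x)" if g: "g \<in> carrier (braid_group m)" for g
  proof -
    have "bij_betw (h g) (Red G A x) (Red G A x)"
      by (rule bij_betw_byWitness[where f' = "h (inv\<^bsub>braid_group m\<^esub> g)"])
        (auto simp: maps g mult[symmetric] one')
    then show ?thesis by (simp add: Bij_def h_def hurwitz_action_def)
  qed
  have "h (g \<otimes>\<^bsub>braid_group m\<^esub> k) = compose (Red G A x) (h g) (h k)"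
    if "g \<in> carrier (braid_group m)" "k \<in> carrier (braid_group m)" for g k
  proof (rule extensionalityI[of _ "Red G A x"])
    show "h (g \<otimes>\<^bsub>braid_group m\<^esub> k) \<in> extensional (Red G A x)"
      by (simp add: h_def hurwitz_action_def)
  qed (simp_all add: compose_def mult that)
  with bij have "h \<in> hom (braid_group m) (BijGroup (Red G A x))"
    by (auto simp: hom_def BijGroup_def)
  then show ?thesis
    unfolding group_action_def group_hom_def group_hom_axioms_def m_def h_def
    by (simp add: group_braid_group group_BijGroup)
qed

end

end

theory Submission
  imports Defs
begin

text \<open>A reduced factorization of \<open>c\<close> and the chain of its prefix products determine each other,
  and every maximal chain arises this way. If two such chains differ in one element, the
  corresponding factorizations differ in two consecutive entries \<open>a, b\<close> only, whose product \<open>a b\<close>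
  is unchanged. As \<open>A\<close> is closed under conjugation, \<open>a b\<close> can be moved to the front of the
  factorization, so it is a prefix of \<open>c\<close> of length 2; local Hurwitz-connectivity then supplies a
  braid on these two strands. Chain-connectivity joins arbitrary factorizations by such steps.\<close>

text \<open>A set, as the members of \<open>max_chains\<close> are; for a reduced word the order of
  the products is recovered from their lengths. Index 0 contributes the unit, the last index the
  full product.\<close>

definition prefix_products :: "('a, 'b) monoid_scheme \<Rightarrow> 'a list \<Rightarrow> 'a set" where
  "prefix_products G as = (\<lambda>i. list_prod G (take i as)) ` {..length as}"

definition reduced_word :: "('a, 'b) monoid_scheme \<Rightarrow> 'a set \<Rightarrow> 'a list \<Rightarrow> bool" where
  "reduced_word G A as \<longleftrightarrow> set as \<subseteq> A \<and> word_length G A (list_prod G as) = length as"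

lemma Red_iff: "as \<in> Red G A x \<longleftrightarrow> reduced_word G A as \<and> list_prod G as = x"
  by (auto simp: Red_def reduced_word_def)

section \<open>Word length and the prefix order\<close>

locale conjugation_closed_generators = group G for G (structure) +
  fixes A :: "'a set"
  assumes generates: "generates_as_monoid G A"
    and conjugation_closed: "conjugation_closed G A"
begin

abbreviation len :: "'a \<Rightarrow> nat" where "len \<equiv> word_length G A"

lemma A_subset: "A \<subseteq> carrier G"
  using generates by (simp add: generates_as_monoid_def)

lemma list_prod_closed: "set as \<subseteq> carrier G \<Longrightarrow> list_prod G as \<in> carrier G"
  using list_prod_append[of as "[]"] by simp

lemma list_prod_append_eq:
  "set as \<subseteq> carrier G \<Longrightarrow> set bs \<subseteq> carrier G \<Longrightarrow>
    list_prod G (as @ bs) = list_prod G as \<otimes> list_prod G bs"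
  using list_prod_append by blast

lemma list_prod_closed_A: "set as \<subseteq> A \<Longrightarrow> list_prod G as \<in> carrier G"
  using list_prod_closed A_subset by blast

lemma list_prod_append_A:
  "set as \<subseteq> A \<Longrightarrow> set bs \<subseteq> A \<Longrightarrow> list_prod G (as @ bs) = list_prod G as \<otimes> list_prod G bs"
  using list_prod_append_eq A_subset by blast

text \<open>Generation as a monoid makes the set under \<open>LEAST\<close> in
  \<open>word_length\<close> nonempty, so the minimum is attained.\<close>

lemma Red_nonempty:
  assumes "x \<in> carrier G"
  obtains as where "as \<in> Red G A x"
proof -
  obtain as where "set as \<subseteq> A" "list_prod G as = x"
    using assms generates by (auto simp: generates_as_monoid_def)
  then have "\<exists>bs. length bs = len x \<and> set bs \<subseteq> A \<and> list_prod G bs = x"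
    unfolding word_length_def by - (rule LeastI_ex, blast)
  then show thesis using that by (auto simp: Red_def)
qed

lemma len_list_prod_le: "set as \<subseteq> A \<Longrightarrow> len (list_prod G as) \<le> length as"
  unfolding word_length_def by (rule Least_le) blast

lemma len_one [simp]: "len \<one> = 0"
  using len_list_prod_le[of "[]"] by (simp add: list_prod_def)

lemma len_eq_0: "x \<in> carrier G \<Longrightarrow> len x = 0 \<Longrightarrow> x = \<one>"
  by (erule Red_nonempty) (auto simp: Red_def list_prod_def)

lemma len_mult_le:
  assumes "x \<in> carrier G" "y \<in> carrier G"
  shows "len (x \<otimes> y) \<le> len x + len y"
proof -
  obtain as bs where "as \<in> Red G A x" "bs \<in> Red G A y"
    using assms Red_nonempty by metis
  then show ?thesis
    using len_list_prod_le[of "as @ bs"] by (auto simp: Red_def list_prod_append_A)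
qed

text \<open>Conjugating each letter conjugates the product, and \<open>conjugation_closed\<close>
  keeps the letters in \<open>A\<close>.\<close>

lemma len_conjugate_le:
  assumes "set as \<subseteq> A" "g \<in> carrier G"
  shows "len (inv g \<otimes> list_prod G as \<otimes> g) \<le> length as"
proof -
  let ?f = "\<lambda>a. inv g \<otimes> a \<otimes> g"
  have "list_prod G (map ?f as) = inv g \<otimes> list_prod G as \<otimes> g \<and> set (map ?f as) \<subseteq> A"
    using assms(1)
  proof (induction as)
    case Nil
    then show ?case using assms(2) by (simp add: list_prod_def)
  next
    case (Cons a as)
    then have "a \<in> carrier G" "list_prod G as \<in> carrier G" "?f a \<in> A"
      using A_subset list_prod_closed_A conjugation_closed assms(2)
      by (auto simp: conjugation_closed_def)
    with Cons assms(2) show ?case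
      by (simp add: list_prod_def m_assoc inv_cancels)
  qed
  then show ?thesis using len_list_prod_le by (metis length_map)
qed

text \<open>By subadditivity of length, a shorter expression for the middle factor would shorten the
  whole word.\<close>

lemma reduced_word_sublist:
  assumes "reduced_word G A (p @ q @ s)"
  shows "reduced_word G A q"
proof -
  have sub: "set p \<subseteq> A" "set q \<subseteq> A" "set s \<subseteq> A"
    using assms by (auto simp: reduced_word_def)
  then have "len (list_prod G (p @ q @ s)) \<le> len (list_prod G p) + (len (list_prod G q) + len (list_prod G s))"
    by (simp add: list_prod_append_A list_prod_closed_A)
      (meson add_left_mono len_mult_le list_prod_closed_A m_closed order_trans)
  then show ?thesis
    using assms sub len_list_prod_le[of p] len_list_prod_le[of q] len_list_prod_le[of s]
    by (auto simp: reduced_word_def)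
qed

lemma reduced_word_take: "reduced_word G A as \<Longrightarrow> reduced_word G A (take i as)"
  using reduced_word_sublist[of "[]" "take i as" "drop i as"] by simp

lemma reduced_word_append_prefix_le:
  assumes "reduced_word G A (p @ q)"
  shows "prefix_le G A (list_prod G p) (list_prod G (p @ q))"
proof -
  have "set p \<subseteq> A" "set q \<subseteq> A" "reduced_word G A p" "reduced_word G A q"
    using assms reduced_word_sublist[of "[]" p q] reduced_word_sublist[of p q "[]"]
    by (auto simp: reduced_word_def)
  then show ?thesis
    using assms
    by (simp add: prefix_le_def reduced_word_def list_prod_append_A list_prod_closed_A inv_cancels)
qed

lemma prefix_le_take:
  assumes "reduced_word G A as" "i \<le> j"
  shows "prefix_le G A (list_prod G (take i as)) (list_prod G (take j as))"
proof -
  have "take j as = take i as @ drop i (take j as)"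
    using assms(2) by (metis append_take_drop_id min.absorb1 take_take)
  then show ?thesis
    using reduced_word_append_prefix_le reduced_word_take[OF assms(1), of j] by metis
qed

text \<open>The prefix relation makes the length of \<open>inv x \<otimes> y\<close> the difference
  of the two lengths, hence 0. Antisymmetry and the use of length as a rank on chains come from
  this.\<close>

lemma prefix_le_len_eq:
  assumes "x \<in> carrier G" "y \<in> carrier G" "prefix_le G A x y" "len y \<le> len x"
  shows "x = y"
proof -
  have "inv x \<otimes> y = \<one>"
    using assms by (intro len_eq_0) (auto simp: prefix_le_def)
  then show ?thesis
    using assms by (metis inv_cancels(1) r_one)
qed

lemma prefix_le_one: "x \<in> carrier G \<Longrightarrow> prefix_le G A \<one> x"
  by (simp add: prefix_le_def)

section \<open>Maximal chains and reduced factorizations\<close>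

lemma factorization_poset_iff:
  "x \<in> factorization_poset G A c \<longleftrightarrow> x \<in> carrier G \<and> prefix_le G A x c"
  by (auto simp: factorization_poset_def prefix_le_one)

lemma list_prod_take_closed: "reduced_word G A as \<Longrightarrow> list_prod G (take i as) \<in> carrier G"
  by (meson list_prod_closed_A reduced_word_def reduced_word_take)

lemma len_list_prod_take:
  "reduced_word G A as \<Longrightarrow> i \<le> length as \<Longrightarrow> len (list_prod G (take i as)) = i"
  using reduced_word_take by (fastforce simp: reduced_word_def)

lemma prefix_products_chain:
  assumes "as \<in> Red G A c"
  shows "pred_on.chain (factorization_poset G A c) (prefix_le G A) (prefix_products G as)"
proof -
  have r: "reduced_word G A as" and c: "list_prod G as = c"
    using assms by (auto simp: Red_iff)
  have "list_prod G (take i as) \<in> factorization_poset G A c" if "i \<le> length as" for i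
    using prefix_le_take[OF r that] list_prod_take_closed[OF r] c
    by (simp add: factorization_poset_iff)
  moreover have "prefix_le G A (list_prod G (take i as)) (list_prod G (take j as)) \<or>
    prefix_le G A (list_prod G (take j as)) (list_prod G (take i as))" for i j
    using prefix_le_take[OF r] nat_le_linear by blast
  ultimately show ?thesis
    unfolding pred_on.chain_def prefix_products_def by auto
qed

lemma chain_len_inj:
  assumes "pred_on.chain (factorization_poset G A c) (prefix_le G A) C"
    and "x \<in> C" "y \<in> C" "len x = len y"
  shows "x = y"
proof -
  have "x \<in> carrier G" "y \<in> carrier G"
    using assms by (auto simp: pred_on.chain_def factorization_poset_iff)
  \<comment> \<open>\<open>pred_on.chain\<close> compares elements by the reflexive closure of the
    relation, hence the case \<open>x = y\<close>.\<close>
  moreover have "x = y \<or> prefix_le G A x y \<or> prefix_le G A y x"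
    using assms unfolding pred_on.chain_def by auto
  ultimately show ?thesis
    using prefix_le_len_eq assms(4) by (metis order_refl)
qed

text \<open>The prefix products already take every length from 0 to \<open>len c\<close>, so by
  \<open>chain_len_inj\<close> a larger chain has no room for another element.\<close>

lemma prefix_products_max_chain:
  assumes "as \<in> Red G A c"
  shows "prefix_products G as \<in> max_chains G A c"
proof -
  have r: "reduced_word G A as" and c: "len c = length as"
    using assms by (auto simp: Red_iff reduced_word_def)
  have "C \<subseteq> prefix_products G as"
    if C: "pred_on.chain (factorization_poset G A c) (prefix_le G A) C"
      and sub: "prefix_products G as \<subseteq> C" for C
  proof
    fix x assume x: "x \<in> C"
    then have "len x \<le> length as"
      using C c by (auto simp: pred_on.chain_def factorization_poset_iff prefix_le_def)
    then have "list_prod G (take (len x) as) \<in> prefix_products G as"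
      and "len (list_prod G (take (len x) as)) = len x"
      using len_list_prod_take[OF r] by (auto simp: prefix_products_def)
    then show "x \<in> prefix_products G as"
      using chain_len_inj[OF C x] sub by (metis subsetD)
  qed
  then show ?thesis
    using prefix_products_chain[OF assms]
    unfolding max_chains_def pred_on.maxchain_def by auto
qed

text \<open>Induction by increasing length: factor the longest element \<open>m\<close> through the
  rest of the chain, then append a reduced word for \<open>inv m \<otimes> c\<close>. The endpoint
  \<open>c\<close> is generalized because the induction hypothesis is applied with \<open>m\<close>
  in its place.\<close>

lemma finite_chain_refinement:
  assumes "finite C"
  shows "C \<subseteq> carrier G \<Longrightarrow> c \<in> carrier G \<Longrightarrow> \<forall>x\<in>C. prefix_le G A x c \<Longrightarrow>
    \<forall>x\<in>C. \<forall>y\<in>C. prefix_le G A x y \<or> prefix_le G A y x \<Longrightarrow>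
    \<exists>as\<in>Red G A c. C \<subseteq> prefix_products G as"
  using assms
proof (induction C arbitrary: c rule: finite_ranking_induct[where f = len])
  case empty
  then show ?case using Red_nonempty by blast
next
  case (insert m C)
  have m: "m \<in> carrier G" and mc: "prefix_le G A m c"
    using insert.prems by auto
  have "prefix_le G A y m" if y: "y \<in> C" for y
  proof -
    have "prefix_le G A m y \<Longrightarrow> m = y"
      using prefix_le_len_eq[of m y] insert.hyps(2)[OF y] insert.prems(1) y by auto
    then show ?thesis using insert.prems(4) y by blast
  qed
  then obtain as where as: "as \<in> Red G A m" "C \<subseteq> prefix_products G as"
    using insert.IH[of m] insert.prems m by auto
  obtain bs where bs: "bs \<in> Red G A (inv m \<otimes> c)"
    using Red_nonempty m insert.prems(2) by (metis inv_closed m_closed)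
  \<comment> \<open>The lengths add up because \<open>m\<close> is a prefix of \<open>c\<close>, so
    the concatenation is again reduced.\<close>
  have "as @ bs \<in> Red G A c"
    using as(1) bs mc m insert.prems(2)
    by (auto simp: Red_def prefix_le_def list_prod_append_A inv_cancels)
  moreover have "prefix_products G as \<subseteq> prefix_products G (as @ bs)"
  proof
    fix x assume "x \<in> prefix_products G as"
    then obtain i where "i \<le> length as" "x = list_prod G (take i as)"
      unfolding prefix_products_def by auto
    then show "x \<in> prefix_products G (as @ bs)"
      unfolding prefix_products_def by (intro image_eqI[where x = i]) auto
  qed
  moreover have "m \<in> prefix_products G (as @ bs)"
    using as(1) unfolding prefix_products_def
    by (intro image_eqI[where x = "length as"]) (auto simp: Red_def)
  ultimately show ?case using as(2) by blast
qed

text \<open>Length injects the chain into \<open>{..len c}\<close>, so it is finite and refined by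
  the prefix products of some factorization; maximality turns the inclusion into equality.\<close>

lemma max_chain_eq_prefix_products:
  assumes "C \<in> max_chains G A c" "c \<in> carrier G"
  obtains as where "as \<in> Red G A c" "C = prefix_products G as"
proof -
  have C: "pred_on.chain (factorization_poset G A c) (prefix_le G A) C"
    and max: "\<And>S. pred_on.chain (factorization_poset G A c) (prefix_le G A) S \<Longrightarrow> \<not> C \<subset> S"
    using assms(1) unfolding max_chains_def pred_on.maxchain_def by auto
  have sub: "C \<subseteq> carrier G" "\<forall>x\<in>C. prefix_le G A x c"
    using C by (auto simp: pred_on.chain_def factorization_poset_iff)
  have "len ` C \<subseteq> {..len c}"
    using sub(2) by (auto simp: prefix_le_def)
  then have fin: "finite C"
    using chain_len_inj[OF C] by (meson finite_atMost finite_imageD finite_subset inj_onI)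
  \<comment> \<open>The refinement lemma also compares an element with itself, where
    \<open>pred_on.chain\<close> yields only equality; reflexivity fills the gap.\<close>
  have "prefix_le G A x x" if "x \<in> C" for x
    using that sub(1) by (auto simp: prefix_le_def subset_iff)
  then have "\<forall>x\<in>C. \<forall>y\<in>C. prefix_le G A x y \<or> prefix_le G A y x"
    using C unfolding pred_on.chain_def by auto
  then obtain as where "as \<in> Red G A c" "C \<subseteq> prefix_products G as"
    using finite_chain_refinement[OF fin sub(1) assms(2) sub(2)] by auto
  with that max[OF prefix_products_chain] show thesis by blast
qed

section \<open>Adjacent maximal chains\<close>

lemma list_prod_take_Suc:
  assumes "set as \<subseteq> carrier G" "i < length as"
  shows "list_prod G (take (Suc i) as) = list_prod G (take i as) \<otimes> as ! i"
proof -
  have "set (take i as) \<subseteq> carrier G" "as ! i \<in> carrier G"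
    using assms set_take_subset[of i as] by auto
  then show ?thesis
    using assms by (simp add: take_Suc_conv_app_nth list_prod_append_eq) (simp add: list_prod_def)
qed

lemma nth_eq_if_take_products_eq:
  assumes "set as \<subseteq> carrier G" "set bs \<subseteq> carrier G" "i < length as" "i < length bs"
    and "list_prod G (take i as) = list_prod G (take i bs)"
    and "list_prod G (take (Suc i) as) = list_prod G (take (Suc i) bs)"
  shows "as ! i = bs ! i"
proof -
  have "list_prod G (take i as) \<otimes> as ! i = list_prod G (take i as) \<otimes> bs ! i"
    using assms by (simp add: list_prod_take_Suc)
  moreover have "list_prod G (take i as) \<in> carrier G"
    using assms(1) set_take_subset[of i as] by (intro list_prod_closed) blast
  moreover have "as ! i \<in> carrier G" "bs ! i \<in> carrier G"
    using assms(1-4) by auto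
  ultimately show ?thesis by simp
qed

text \<open>The length of a prefix product of a reduced word is its index, so a match can only occur
  at the same index.\<close>

lemma take_product_eq_if_mem:
  assumes "reduced_word G A as" "reduced_word G A bs" "i \<le> length as"
    and "list_prod G (take i as) \<in> prefix_products G bs"
  shows "list_prod G (take i as) = list_prod G (take i bs)"
proof -
  obtain j where "j \<le> length bs" "list_prod G (take i as) = list_prod G (take j bs)"
    using assms(4) unfolding prefix_products_def by auto
  then show ?thesis
    using len_list_prod_take assms(1-3) by metis
qed

text \<open>Only the prefix product at one inner index \<open>k\<close> changes. It enters just the
  letters at 0-based positions \<open>k - 1\<close> and \<open>k\<close>, whose product is fixed by
  the common prefix products at \<open>k - 1\<close> and \<open>k + 1\<close>.\<close>

lemma adjacent_chains_factorizations:
  assumes as: "as \<in> Red G A c" and bs: "bs \<in> Red G A c"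
    and adj: "(prefix_products G as, prefix_products G bs) \<in> chain_graph G A c"
  obtains p a b a' b' s where "as = p @ [a, b] @ s" "bs = p @ [a', b'] @ s" "a \<otimes> b = a' \<otimes> b'"
proof -
  let ?pa = "\<lambda>i. list_prod G (take i as)" and ?pb = "\<lambda>i. list_prod G (take i bs)"
  have ra: "reduced_word G A as" and rb: "reduced_word G A bs"
    and ca: "list_prod G as = c" and cb: "list_prod G bs = c"
    using as bs by (auto simp: Red_iff)
  have len: "length bs = length as"
    using as bs by (simp add: Red_def)
  have sub: "set as \<subseteq> carrier G" "set bs \<subseteq> carrier G"
    using as bs A_subset by (auto simp: Red_def)
  have "card (prefix_products G as - prefix_products G bs) = 1"
    using adj by (simp add: chain_graph_def)
  then obtain x where x: "prefix_products G as - prefix_products G bs = {x}"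
    by (auto simp: card_1_singleton_iff)
  then obtain k where k_le: "k \<le> length as" and x_eq: "x = ?pa k"
    unfolding prefix_products_def by auto
  \<comment> \<open>Lengths tell indices apart, so this product is not \<open>x\<close> and hence
    lies in the other chain too.\<close>
  have eq: "?pa i = ?pb i" if i: "i \<le> length as" "i \<noteq> k" for i
  proof -
    have "?pa i \<noteq> x"
      using len_list_prod_take[OF ra] i k_le x_eq by metis
    then have "?pa i \<in> prefix_products G bs"
      using x i unfolding prefix_products_def by blast
    then show ?thesis
      by (rule take_product_eq_if_mem[OF ra rb i(1)])
  qed
  have ne: "?pa k \<noteq> ?pb k"
    using x x_eq k_le len unfolding prefix_products_def by force
  \<comment> \<open>Index 0 gives the unit in both words and the last index gives \<open>c\<close>,
    so the changed index is strictly inside.\<close>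
  have k0: "1 \<le> k"
    using ne by (cases k) (auto simp: list_prod_def)
  have kn: "k < length as"
    using ne k_le len ca cb by (cases "k = length as") auto
  have nth: "as ! i = bs ! i" if "i < length as" "i \<noteq> k" "Suc i \<noteq> k" for i
    by (rule nth_eq_if_take_products_eq[OF sub]) (use that len eq in auto)
  obtain p a b s where asp: "as = p @ a # b # s" "length p = k - 1"
    by (rule list_split2[OF k0 kn])
  obtain p' a' b' s' where bsp: "bs = p' @ a' # b' # s'" "length p' = k - 1"
    by (rule list_split2[OF k0 kn[folded len]])
  have p: "p' = p"
  proof (rule nth_equalityI)
    fix i assume "i < length p'"
    then show "p' ! i = p ! i"
      using nth[of i] asp bsp by (simp add: nth_append)
  qed (simp add: asp bsp)
  have "length s' = length s"
    using len asp bsp by simp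
  have k: "k = Suc (length p)"
    using asp(2) k0 by simp
  have "s' = s"
  proof (rule nth_equalityI)
    show "length s' = length s" by fact
    fix i assume "i < length s'"
    then show "s' ! i = s ! i"
      using nth[of "length p + 2 + i"] \<open>length s' = length s\<close> asp(1) bsp(1) k p
      by (simp add: nth_append)
  qed
  moreover have "a \<otimes> b = a' \<otimes> b'"
  proof -
    have "list_prod G p \<otimes> (a \<otimes> b) = list_prod G p \<otimes> (a' \<otimes> b')"
      using eq[of "Suc k"] kn asp(1) bsp(1) k sub p list_prod_append_eq[of p "[a, b]"]
        list_prod_append_eq[of p "[a', b']"]
      by (auto simp: list_prod_def)
    then show ?thesis
      using sub asp(1) bsp(1) list_prod_closed[of p] by simp
  qed
  ultimately show thesis using that asp(1) bsp(1) p by simp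
qed

text \<open>The identity p q s = q (inv q p q) s moves the middle factor to the front. The conjugate
  of p needs at most \<open>length p\<close> letters, and subadditivity of length gives the opposite
  bound.\<close>

lemma prefix_le_middle_factor:
  assumes "p @ q @ s \<in> Red G A c"
  shows "prefix_le G A (list_prod G q) c"
proof -
  let ?p = "list_prod G p" and ?q = "list_prod G q" and ?s = "list_prod G s"
  have r: "reduced_word G A (p @ q @ s)" and c: "list_prod G (p @ q @ s) = c"
    using assms by (auto simp: Red_iff)
  then have sub: "set p \<subseteq> A" "set q \<subseteq> A" "set s \<subseteq> A"
    by (auto simp: reduced_word_def)
  then have cl: "?p \<in> carrier G" "?q \<in> carrier G" "?s \<in> carrier G"
    by (auto intro: list_prod_closed_A)
  have ceq: "c = ?p \<otimes> (?q \<otimes> ?s)"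
    using c sub by (simp add: list_prod_append_A)
  have "inv ?q \<otimes> c = (inv ?q \<otimes> ?p \<otimes> ?q) \<otimes> ?s"
    using cl by (simp add: ceq m_assoc)
  then have "len (inv ?q \<otimes> c) \<le> len (inv ?q \<otimes> ?p \<otimes> ?q) + len ?s"
    using cl len_mult_le by simp
  also have "\<dots> \<le> length p + length s"
    using len_conjugate_le[OF sub(1) cl(2)] len_list_prod_le[OF sub(3)] by simp
  finally have "len (inv ?q \<otimes> c) \<le> length p + length s" .
  moreover have "len c = length p + length q + length s" "len ?q = length q"
    using r c reduced_word_sublist[OF r] by (auto simp: reduced_word_def)
  moreover have "len c \<le> len ?q + len (inv ?q \<otimes> c)"
    using len_mult_le[of ?q "inv ?q \<otimes> c"] cl ceq by (simp add: inv_cancels)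
  ultimately show ?thesis by (simp add: prefix_le_def)
qed

end

section \<open>Braids acting on a block of consecutive strands\<close>

primrec shift_letter :: "nat \<Rightarrow> braid_letter \<Rightarrow> braid_letter" where
  "shift_letter k (Gen i) = Gen (k + i)"
| "shift_letter k (GenInv i) = GenInv (k + i)"

lemma letter_index_shift [simp]: "letter_index (shift_letter k l) = k + letter_index l"
  by (cases l) auto

lemma hurwitz_letter_length: "length (hurwitz_letter G l as) = length as"
  by (cases l) (auto simp: Let_def)

lemma hurwitz_word_length: "length (hurwitz_word G w as) = length as"
  by (induction w) (auto simp: hurwitz_word_def hurwitz_letter_length)

lemma hurwitz_letter_shift:
  assumes "1 \<le> letter_index l" "letter_index l < length as"
  shows "hurwitz_letter G (shift_letter (length p) l) (p @ as @ s) = p @ hurwitz_letter G l as @ s"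
proof -
  obtain q a b r where as: "as = q @ a # b # r" "length q = letter_index l - 1"
    by (rule list_split2[OF assms])
  show ?thesis
  proof (cases l)
    case (Gen i)
    then show ?thesis
      using as assms hurwitz_Gen_split(1)[of q i G a b r]
        hurwitz_Gen_split(1)[of "p @ q" "length p + i" G a b "r @ s"]
      by (simp del: hurwitz_letter.simps)
  next
    case (GenInv i)
    then show ?thesis
      using as assms hurwitz_Gen_split(2)[of q i G a b r]
        hurwitz_Gen_split(2)[of "p @ q" "length p + i" G a b "r @ s"]
      by (simp del: hurwitz_letter.simps)
  qed
qed

text \<open>Hurwitz letters preserve length, so the block keeps its size and every shifted letter of
  the word acts inside it.\<close>

lemma hurwitz_word_shift:
  assumes "w \<in> braid_words (length as)"
  shows "hurwitz_word G (map (shift_letter (length p)) w) (p @ as @ s) = p @ hurwitz_word G w as @ s"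
  using assms
proof (induction w)
  case (Cons l w)
  then show ?case
    using hurwitz_letter_shift[of l "hurwitz_word G w as" G p s] hurwitz_word_length[of G w as]
    by (auto simp: hurwitz_word_def braid_words_def simp del: hurwitz_letter.simps)
qed (simp add: hurwitz_word_def)

lemma shift_braid_words:
  "w \<in> braid_words m \<Longrightarrow> k + m \<le> n \<Longrightarrow> map (shift_letter k) w \<in> braid_words n"
  by (fastforce simp: braid_words_def)

section \<open>Hurwitz reachability along paths of chains\<close>

context conjugation_closed_generators
begin

text \<open>Phrased with braid words rather than classes in \<open>braid_group\<close>, so that
  words can be concatenated and shifted directly.\<close>

definition hurwitz_reachable :: "'a \<Rightarrow> 'a list \<Rightarrow> 'a list \<Rightarrow> bool" where
  "hurwitz_reachable c as bs \<longleftrightarrow> (\<exists>w\<in>braid_words (len c). hurwitz_word G w as = bs)"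

text \<open>Carrier elements are classes of braid words, and by \<open>hurwitz_action_class\<close>
  a class acts as any of its representatives does.\<close>

lemma transitive_action_iff_hurwitz_reachable:
  "transitive_action (braid_group (len c)) (Red G A c) (hurwitz_action G A c) \<longleftrightarrow>
    (\<forall>as\<in>Red G A c. \<forall>bs\<in>Red G A c. hurwitz_reachable c as bs)"
proof -
  have act: "group_action (braid_group (len c)) (Red G A c) (hurwitz_action G A c)"
    by (rule hurwitz_group_action[OF A_subset conjugation_closed])
  have "(\<exists>g\<in>carrier (braid_group (len c)). hurwitz_action G A c g as = bs) \<longleftrightarrow>
      hurwitz_reachable c as bs" if "as \<in> Red G A c" for as bs
    using that hurwitz_action_class[OF A_subset conjugation_closed, of _ c as]
    unfolding hurwitz_reachable_def braid_group_def
    by (auto simp: quotient_def)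
  then show ?thesis
    using act unfolding transitive_action_def transitive_action_axioms_def by blast
qed

lemma hurwitz_reachable_trans:
  "hurwitz_reachable c as bs \<Longrightarrow> hurwitz_reachable c bs cs \<Longrightarrow> hurwitz_reachable c as cs"
  unfolding hurwitz_reachable_def by (metis braid_words_append hurwitz_word_append)

lemma adjacent_chains_hurwitz_reachable:
  assumes "locally_hurwitz_connected G A c" and as: "as \<in> Red G A c" and bs: "bs \<in> Red G A c"
    and "(prefix_products G as, prefix_products G bs) \<in> chain_graph G A c"
  shows "hurwitz_reachable c as bs"
proof -
  obtain p a b a' b' s where asp: "as = p @ [a, b] @ s" and bsp: "bs = p @ [a', b'] @ s"
    and eq: "a \<otimes> b = a' \<otimes> b'"
    using adjacent_chains_factorizations[OF as bs assms(4)] by metis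
  have c: "len c = length p + 2 + length s"
    using as asp by (simp add: Red_def)
  define g where "g = list_prod G [a, b]"
  have "reduced_word G A [a, b]" "reduced_word G A [a', b']"
    using as bs asp bsp reduced_word_sublist by (metis Red_iff)+
  moreover from this have "a \<in> carrier G" "b \<in> carrier G" "a' \<in> carrier G" "b' \<in> carrier G"
    using A_subset by (auto simp: reduced_word_def)
  ultimately have red: "[a, b] \<in> Red G A g" "[a', b'] \<in> Red G A g"
    and g: "len g = 2" "g \<in> carrier G"
    using eq by (auto simp: g_def Red_iff reduced_word_def list_prod_def)
  \<comment> \<open>The pair may sit anywhere in the word, yet closure under conjugation makes its
    product a prefix of \<open>c\<close>, as the local hypothesis demands.\<close>
  have "prefix_le G A g c"
    unfolding g_def by (rule prefix_le_middle_factor) (use as asp in simp)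
  then have "transitive_action (braid_group 2) (Red G A g) (hurwitz_action G A g)"
    using assms(1) g by (simp add: locally_hurwitz_connected_def)
  then have "hurwitz_reachable g [a, b] [a', b']"
    using transitive_action_iff_hurwitz_reachable[of g] g(1) red by simp
  then obtain w where w: "w \<in> braid_words 2" "hurwitz_word G w [a, b] = [a', b']"
    using g(1) by (auto simp: hurwitz_reachable_def)
  then have "hurwitz_word G (map (shift_letter (length p)) w) as = bs"
    using hurwitz_word_shift[of w "[a, b]" G p s] asp bsp by (simp add: numeral_2_eq_2)
  moreover have "map (shift_letter (length p)) w \<in> braid_words (len c)"
    using shift_braid_words[OF w(1)] c by simp
  ultimately show ?thesis
    unfolding hurwitz_reachable_def by blast
qed

text \<open>The word is read off the chain: length picks out the prefix product at each index, and
  consecutive ones determine the letter.\<close>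

lemma prefix_products_inj:
  assumes as: "as \<in> Red G A c" and bs: "bs \<in> Red G A c"
    and eq: "prefix_products G as = prefix_products G bs"
  shows "as = bs"
proof (rule nth_equalityI)
  have ra: "reduced_word G A as" and rb: "reduced_word G A bs"
    using as bs by (auto simp: Red_iff)
  show len: "length as = length bs"
    using as bs by (simp add: Red_def)
  have sub: "set as \<subseteq> carrier G" "set bs \<subseteq> carrier G"
    using as bs A_subset by (auto simp: Red_def)
  have "list_prod G (take i as) \<in> prefix_products G bs" if "i \<le> length as" for i
    unfolding eq[symmetric] using that by (simp add: prefix_products_def)
  then have "list_prod G (take i as) = list_prod G (take i bs)" if "i \<le> length as" for i
    using take_product_eq_if_mem[OF ra rb] that by blast
  then show "as ! i = bs ! i" if "i < length as" for i
    using nth_eq_if_take_products_eq[OF sub, of i] that len by simp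
qed

text \<open>Induction along the path. The factorization \<open>bs\<close> stays arbitrary so that
  the induction hypothesis applies to one chosen for the intermediate chain.\<close>

lemma chain_path_hurwitz_reachable:
  assumes "locally_hurwitz_connected G A c" "c \<in> carrier G" "as \<in> Red G A c"
    and "(prefix_products G as, D) \<in> (chain_graph G A c)\<^sup>*"
  shows "bs \<in> Red G A c \<Longrightarrow> D = prefix_products G bs \<Longrightarrow> hurwitz_reachable c as bs"
  using assms(4)
proof (induction arbitrary: bs rule: rtrancl_induct)
  case base
  \<comment> \<open>The path ends where it starts, so both words have the same chain and coincide;
    the empty braid word serves.\<close>
  then have "as = bs"
    using prefix_products_inj assms(3) by blast
  then show ?case
    unfolding hurwitz_reachable_def by (intro bexI[of _ "[]"]) (auto simp: hurwitz_word_def)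
next
  case (step C D)
  \<comment> \<open>Vertices of the chain graph are maximal chains, so \<open>C\<close> comes from
    some factorization \<open>cs\<close> to pass through.\<close>
  then have "C \<in> max_chains G A c"
    by (simp add: chain_graph_def)
  then obtain cs where "cs \<in> Red G A c" "C = prefix_products G cs"
    using max_chain_eq_prefix_products assms(2) by blast
  with step show ?case
    using adjacent_chains_hurwitz_reachable[OF assms(1)] hurwitz_reachable_trans by blast
qed

end

theorem theorem4p7:
  fixes G :: "('a, 'b) monoid_scheme" and A :: "'a set" and c :: 'a and n :: nat
  assumes "group G"
    and "generates_as_monoid G A"
    and "conjugation_closed G A"
    and "c \<in> carrier G"
    and "word_length G A c = n"
    and "chain_connected G A c"
    and "locally_hurwitz_connected G A c"
  shows "transitive_action (braid_group n) (Red G A c) (hurwitz_action G A c)"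
proof -
  interpret conjugation_closed_generators G A
    using assms(1-3)
    by (simp add: conjugation_closed_generators_def conjugation_closed_generators_axioms_def)
  \<comment> \<open>Both sets of prefix products are maximal chains, so chain-connectedness supplies
    the path.\<close>
  have "hurwitz_reachable c as bs" if "as \<in> Red G A c" "bs \<in> Red G A c" for as bs
    using chain_path_hurwitz_reachable[OF assms(7,4)] that prefix_products_max_chain assms(6)
    unfolding chain_connected_def by blast
  then show ?thesis
    using transitive_action_iff_hurwitz_reachable[of c] assms(5) by blast
qed

end
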